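(* Let $n,r$ be positive integers with $n\ge 2r+1$. Let $P$ be the matrix with rows indexed by the $r$-element subsets of $[n]$ and columns indexed by the elements of $[n]$, with $P_{S,i}=r-n$ if $i\in S$ and $P_{S,i}=r$ if $i\notin S$. For each vertex $S$ of the Kneser graph $K_{n:r}$ let $p_S\in\mathbb R^{n}$ be the transpose of the $S$-row of $P$. Then, viewing $K_{n:r}$ as a tensegrity graph with no cables (each edge a bar or a strut), the tensegrity framework $K_{n:r}(\mathbf p)$ is universally completable.
   Context: The Kneser graph $K_{n:r}$ has as vertices the $r$-element subsets of $[n]$, two being adjacent if they are disjoint. A tensegrity graph is a graph whose edge set is partitioned into bars $B$, cables $C$ and struts $S$; a tensegrity framework assigns real column vectors $p_v$ to its vertices. For frameworks $G(\mathbf p)$ and $G(\mathbf q)$ (the $q_v$ may lie in a real space of any dimension), $G(\mathbf p)$ dominates $G(\mathbf q)$ if $q_u^Tq_v=p_u^Tp_v$ for $uv\in B$ and for $u=v$, $q_u^Tq_v\ge p_u^Tp_v$ for $uv\in C$, and $q_u^Tq_v\le p_u^Tp_v$ for $uv\in S$. The framework is universally completable if every framework it dominates has the same Gram matrix. *)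

theory Defs
  imports "Jordan_Normal_Form.Matrix" "HOL-Library.FuncSet"
begin

text \<open>A finite simple graph is a pair of a vertex set and a set of two-element sets of vertices.\<close>

type_synonym 'a ugraph = "'a set \<times> 'a set set"

definition simple_graph :: "'a ugraph \<Rightarrow> bool" where
  "simple_graph G \<longleftrightarrow> finite (fst G) \<and> (\<forall>e \<in> snd G. e \<subseteq> fst G \<and> card e = 2)"

definition kneser_graph :: "nat \<Rightarrow> nat \<Rightarrow> nat set ugraph" where
  "kneser_graph n r =
    (let V = {S. S \<subseteq> {1..n} \<and> card S = r}
     in (V, {{S, T} | S T. S \<in> V \<and> T \<in> V \<and> S \<inter> T = {}}))"

record 'a tensegrity =
  verts :: "'a set"
  bars :: "'a set set"
  cables :: "'a set set"
  struts :: "'a set set"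

definition underlying_graph :: "'a tensegrity \<Rightarrow> 'a ugraph" where
  "underlying_graph G = (verts G, bars G \<union> cables G \<union> struts G)"

text \<open>The classes of the partition may be empty.\<close>

definition tensegrity_graph :: "'a tensegrity \<Rightarrow> bool" where
  "tensegrity_graph G \<longleftrightarrow>
     simple_graph (underlying_graph G) \<and>
     bars G \<inter> cables G = {} \<and> bars G \<inter> struts G = {} \<and> cables G \<inter> struts G = {}"

definition tensegrity_framework :: "'a tensegrity \<Rightarrow> nat \<Rightarrow> ('a \<Rightarrow> real vec) \<Rightarrow> bool" where
  "tensegrity_framework G d p \<longleftrightarrow> tensegrity_graph G \<and> (\<forall>v \<in> verts G. p v \<in> carrier_vec d)"

definition gram_matrix :: "'a tensegrity \<Rightarrow> ('a \<Rightarrow> real vec) \<Rightarrow> 'a \<times> 'a \<Rightarrow> real" where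
  "gram_matrix G p = (\<lambda>(u, v) \<in> verts G \<times> verts G. p u \<bullet> p v)"

definition dominates :: "'a tensegrity \<Rightarrow> ('a \<Rightarrow> real vec) \<Rightarrow> ('a \<Rightarrow> real vec) \<Rightarrow> bool" where
  "dominates G p q \<longleftrightarrow>
     (\<forall>v \<in> verts G. q v \<bullet> q v = p v \<bullet> p v) \<and>
     (\<forall>u v. {u, v} \<in> bars G \<longrightarrow> q u \<bullet> q v = p u \<bullet> p v) \<and>
     (\<forall>u v. {u, v} \<in> cables G \<longrightarrow> q u \<bullet> q v \<ge> p u \<bullet> p v) \<and>
     (\<forall>u v. {u, v} \<in> struts G \<longrightarrow> q u \<bullet> q v \<le> p u \<bullet> p v)"

text \<open>The dimension \<open>e\<close> of the dominated framework is arbitrary and unrelated to \<open>d\<close>.\<close>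

definition universally_completable :: "'a tensegrity \<Rightarrow> nat \<Rightarrow> ('a \<Rightarrow> real vec) \<Rightarrow> bool" where
  "universally_completable G d p \<longleftrightarrow>
     tensegrity_framework G d p \<and>
     (\<forall>e q. tensegrity_framework G e q \<and> dominates G p q \<longrightarrow> gram_matrix G q = gram_matrix G p)"

definition kneser_P :: "nat \<Rightarrow> nat \<Rightarrow> nat set \<Rightarrow> nat \<Rightarrow> real" where
  "kneser_P n r S i = (if i \<in> S then real r - real n else real r)"

text \<open>Coordinates of \<^typ>\<open>real vec\<close> are numbered from \<open>0\<close>, the columns of the matrix from \<open>1\<close>.\<close>

definition kneser_vec :: "nat \<Rightarrow> nat \<Rightarrow> nat set \<Rightarrow> real vec" where
  "kneser_vec n r S = vec n (\<lambda>i. kneser_P n r S (i + 1))"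

end

theory Submission
  imports Defs "HOL-Analysis.Function_Topology"
begin

text \<open>
  Let \<open>A\<close> be the adjacency operator of \<open>K(n, r)\<close> and \<open>d\<close> the degree of \<open>K(n - 2, r - 1)\<close>. The swap
  difference \<open>f (S + x) - f (S + y)\<close> turns an eigenfunction of \<open>A\<close> with eigenvalue \<open>m\<close> into one of
  \<open>K(n - 2, r - 1)\<close> with eigenvalue \<open>- m\<close>, or into zero. The eigenvalues of a graph do not exceed
  its degree, so \<open>A + d I\<close> is positive semidefinite. On its kernel all swap differences are
  eigenfunctions for the degree, hence constant since the smaller Kneser graph is connected, so a
  kernel function has the form \<open>f S = (\<Sum>i\<in>S. a i)\<close>.

  The columns of \<open>P\<close> lie in this kernel. If \<open>Q\<close> is the Gram matrix of a dominated framework, then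
  \<open>tr ((A + d I) Q) \<le> tr ((A + d I) P P\<^sup>T) = 0\<close>; therefore the coordinates of the dominated framework
  lie in the kernel too, and \<open>Q\<close> agrees with \<open>P P\<^sup>T\<close> on all edges. The difference is then
  \<open>(\<Sum>i\<in>S. \<Sum>j\<in>T. B i j)\<close>, which vanishes for disjoint and for equal \<open>S, T\<close>, and this forces \<open>B = 0\<close>.
\<close>

section \<open>Quadratic forms of symmetric real matrices\<close>

definition apply_mat :: "('a \<Rightarrow> 'a \<Rightarrow> real) \<Rightarrow> 'a set \<Rightarrow> ('a \<Rightarrow> real) \<Rightarrow> 'a \<Rightarrow> real" where
  "apply_mat M V f u = (\<Sum>v\<in>V. M u v * f v)"

definition quad_form :: "('a \<Rightarrow> 'a \<Rightarrow> real) \<Rightarrow> 'a set \<Rightarrow> ('a \<Rightarrow> real) \<Rightarrow> real" where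
  "quad_form M V f = (\<Sum>u\<in>V. f u * apply_mat M V f u)"

text \<open>Moving \<open>f\<close> by \<open>t\<close> in the coordinate \<open>w\<close> changes
  the form from 0 to \<open>2 * t * a + t^2 * M w w\<close>. Nonnegativity for all \<open>t\<close>
  forces the linear coefficient \<open>a\<close> to vanish.\<close>

lemma psd_kernel:
  assumes V: "finite V" and sym: "\<And>u v. M u v = M v u"
    and psd: "\<And>g. 0 \<le> quad_form M V g"
    and zero: "quad_form M V f = 0" and w: "w \<in> V"
  shows "apply_mat M V f w = 0"
proof -
  define a where "a = apply_mat M V f w"
  \<comment> \<open>At \<open>t = - a / k\<close> the form is at most \<open>- (a^2 / k)\<close>.
    The summand 1 keeps this upper bound of \<open>M w w\<close> strictly positive.\<close>
  define k where "k = \<bar>M w w\<bar> + 1"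
  have ineq: "0 \<le> 2 * t * a + t^2 * M w w" for t
  proof -
    define g where "g = (\<lambda>v. f v + t * of_bool (v = w))"
    have ap: "apply_mat M V g u = apply_mat M V f u + t * M u w" for u
    proof -
      have "apply_mat M V g u = (\<Sum>v\<in>V. M u v * f v + (if v = w then t * M u w else 0))"
        unfolding apply_mat_def g_def by (rule sum.cong) (auto simp: algebra_simps)
      also have "\<dots> = apply_mat M V f u + t * M u w"
        using V w by (simp add: sum.distrib apply_mat_def)
      finally show ?thesis .
    qed
    have "quad_form M V g = (\<Sum>u\<in>V. f u * apply_mat M V f u + t * (M u w * f u)
            + (if u = w then t * (a + t * M w w) else 0))"
      unfolding quad_form_def ap
      by (rule sum.cong) (auto simp: g_def a_def algebra_simps)
    also have "\<dots> = quad_form M V f + t * (\<Sum>u\<in>V. M u w * f u) + t * (a + t * M w w)"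
      using V w by (simp add: sum.distrib sum_distrib_left quad_form_def)
    also have "(\<Sum>u\<in>V. M u w * f u) = a"
      unfolding a_def apply_mat_def by (rule sum.cong) (simp_all add: sym[of w])
    also have "quad_form M V f + t * a + t * (a + t * M w w) = 2 * t * a + t^2 * M w w"
      using zero by (simp add: power2_eq_square algebra_simps)
    finally show ?thesis using psd[of g] by simp
  qed
  have k: "k > 0" "M w w \<le> k" by (auto simp: k_def)
  have "0 \<le> 2 * (- a / k) * a + (- a / k)^2 * M w w" by (rule ineq)
  also have "\<dots> \<le> 2 * (- a / k) * a + (- a / k)^2 * k"
    using k by (intro add_left_mono mult_left_mono) auto
  also have "\<dots> = - (a^2 / k)" using k by (simp add: field_simps power2_eq_square)
  finally have "a^2 \<le> 0" using k by (simp add: field_simps)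
  then show ?thesis by (simp add: a_def)
qed

lemma quad_form_cong:
  assumes "\<And>v. v \<in> V \<Longrightarrow> f v = g v"
  shows "quad_form M V f = quad_form M V g"
  unfolding quad_form_def apply_mat_def using assms by simp

lemma quad_form_scale: "quad_form M V (\<lambda>v. c * f v) = c^2 * quad_form M V f"
proof -
  have "apply_mat M V (\<lambda>v. c * f v) u = c * apply_mat M V f u" for u
    unfolding apply_mat_def sum_distrib_left by (simp add: mult.left_commute)
  then show ?thesis
    unfolding quad_form_def sum_distrib_left by (simp add: power2_eq_square mult_ac)
qed

text \<open>A minimiser of the Rayleigh quotient is an eigenvector, so no spectral theorem is needed.\<close>

lemma psd_if_eigenvalues_nonneg:
  assumes V: "finite V" and sym: "\<And>u v. M u v = M v u"
    and eig: "\<And>l f. \<exists>v\<in>V. f v \<noteq> 0 \<Longrightarrow> \<forall>v\<in>V. apply_mat M V f v = l * f v \<Longrightarrow> 0 \<le> l"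
  shows "0 \<le> quad_form M V g"
proof (cases "V = {}")
  case True
  then show ?thesis by (simp add: quad_form_def)
next
  case False
  then obtain v0 where v0: "v0 \<in> V" by blast
  \<comment> \<open>Coordinates outside \<open>V\<close> are pinned to 0, so that this cube is
    compact by Tychonoff although the functions live on the whole type. \<open>K\<close> is the unit
    sphere inside it.\<close>
  define B :: "('a \<Rightarrow> real) set" where "B = PiE UNIV (\<lambda>v. if v \<in> V then {-1..1} else {0})"
  define K where "K = B \<inter> {f. (\<Sum>v\<in>V. (f v)^2) = 1}"
  have "compactin (product_topology (\<lambda>_. euclidean) UNIV) B"
    unfolding B_def compactin_PiE by auto
  then have "compact B" by (simp add: euclidean_product_topology)
  moreover have coord: "continuous_on A (\<lambda>f. f v)" for A :: "('a \<Rightarrow> real) set" and v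
    by (rule continuous_on_product_then_coordinatewise) (rule continuous_on_id)
  have "closed {f :: 'a \<Rightarrow> real. (\<Sum>v\<in>V. (f v)^2) = 1}"
    by (intro closed_Collect_eq continuous_intros coord)
  ultimately have "compact K" unfolding K_def by (rule compact_Int_closed)
  moreover have "(\<lambda>v. of_bool (v = v0)) \<in> K"
  proof -
    have "(\<Sum>v\<in>V. (of_bool (v = v0))^2) = (\<Sum>v\<in>V. if v = v0 then 1 else (0::real))"
      by (rule sum.cong) auto
    then show ?thesis using v0 V by (auto simp: K_def B_def)
  qed
  then have "K \<noteq> {}" by blast
  moreover have "continuous_on K (quad_form M V)"
    unfolding quad_form_def apply_mat_def by (intro continuous_intros coord)
  ultimately obtain f where f: "f \<in> K" and min: "\<And>h. h \<in> K \<Longrightarrow> quad_form M V f \<le> quad_form M V h"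
    using continuous_attains_inf by metis
  define l where "l = quad_form M V f"
  have f1: "(\<Sum>v\<in>V. (f v)^2) = 1" using f by (simp add: K_def)
  \<comment> \<open>Homogeneity carries the minimum on the unit sphere over to all \<open>h\<close>;
    cutting the rescaled \<open>h\<close> off outside \<open>V\<close> puts it into \<open>K\<close>
    and leaves the form unchanged.\<close>
  have bound: "l * (\<Sum>v\<in>V. (h v)^2) \<le> quad_form M V h" for h
  proof (cases "(\<Sum>v\<in>V. (h v)^2) = 0")
    case True
    then have "\<forall>v\<in>V. h v = 0" using V by (simp add: sum_nonneg_eq_0_iff)
    then show ?thesis by (simp add: quad_form_def)
  next
    case ne: False
    define s where "s = (\<Sum>v\<in>V. (h v)^2)"
    have s: "s > 0" using ne sum_nonneg[of V "\<lambda>v. (h v)^2"] by (simp add: s_def)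
    define h' where "h' = (\<lambda>v. if v \<in> V then 1 / sqrt s * h v else 0)"
    have "(\<Sum>v\<in>V. (h' v)^2) = (\<Sum>v\<in>V. (h v)^2 / s)"
      using s by (intro sum.cong) (auto simp: h'_def power_mult_distrib power_divide)
    also have "\<dots> = 1" using s by (simp add: sum_divide_distrib[symmetric] s_def)
    finally have one: "(\<Sum>v\<in>V. (h' v)^2) = 1" .
    have "\<bar>h' v\<bar> \<le> 1" if "v \<in> V" for v
    proof -
      have "(h' v)^2 \<le> (\<Sum>v\<in>V. (h' v)^2)"
        using that V by (intro member_le_sum) auto
      then show ?thesis using one by (simp add: abs_square_le_1)
    qed
    then have "- 1 \<le> h' v \<and> h' v \<le> 1" if "v \<in> V" for v using that by (auto simp: abs_le_iff)
    moreover have "h' v = 0" if "v \<notin> V" for v using that by (simp add: h'_def)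
    ultimately have "h' \<in> K" using one by (simp add: K_def B_def PiE_def Pi_def)
    then have "l \<le> quad_form M V h'" unfolding l_def by (rule min)
    also have "\<dots> = quad_form M V (\<lambda>v. 1 / sqrt s * h v)"
      by (rule quad_form_cong) (simp add: h'_def)
    also have "\<dots> = quad_form M V h / s"
      using s by (simp only: quad_form_scale) (simp add: power_divide)
    finally show ?thesis using s by (simp add: field_simps s_def)
  qed
  \<comment> \<open>By \<open>bound\<close> the shift of \<open>M\<close> by \<open>- l\<close> is
    positive semidefinite, and its form vanishes at \<open>f\<close>; so \<open>f\<close> lies in
    its kernel and is an eigenvector of \<open>M\<close> for \<open>l\<close>.\<close>
  define M' where "M' = (\<lambda>u v. M u v - l * of_bool (u = v))"
  have ap': "apply_mat M' V h u = apply_mat M V h u - l * h u" if "u \<in> V" for h u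
  proof -
    have "apply_mat M' V h u = (\<Sum>v\<in>V. M u v * h v - (if v = u then l * h u else 0))"
      unfolding apply_mat_def M'_def by (rule sum.cong) (auto simp: algebra_simps)
    then show ?thesis using V that by (simp add: sum_subtractf apply_mat_def)
  qed
  have qf': "quad_form M' V h = quad_form M V h - l * (\<Sum>v\<in>V. (h v)^2)" for h
    by (simp add: quad_form_def ap' algebra_simps sum_subtractf sum_distrib_left power2_eq_square)
  have "apply_mat M' V f v = 0" if "v \<in> V" for v
  proof (rule psd_kernel[OF V _ _ _ that])
    show "M' u v = M' v u" for u v by (auto simp: M'_def sym)
    show "0 \<le> quad_form M' V h" for h using bound by (simp add: qf')
    show "quad_form M' V f = 0" by (simp add: qf' f1 l_def)
  qed
  then have "\<forall>v\<in>V. apply_mat M V f v = l * f v" by (simp add: ap')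
  moreover have "\<exists>v\<in>V. f v \<noteq> 0"
  proof (rule ccontr)
    assume "\<not> ?thesis"
    then show False using f1 by simp
  qed
  ultimately have "0 \<le> l" by (rule eig[rotated])
  then have "0 \<le> l * (\<Sum>v\<in>V. (g v)^2)" by (simp add: sum_nonneg)
  then show ?thesis using bound[of g] by linarith
qed

section \<open>Sums over disjoint subsets and connectedness of Kneser graphs\<close>

definition ksubsets :: "'a set \<Rightarrow> nat \<Rightarrow> 'a set set" where
  "ksubsets X k = {S. S \<subseteq> X \<and> card S = k}"

text \<open>On \<open>ksubsets X k\<close> this is the Kneser adjacency operator. For
  \<open>k = 0\<close>, which arises from \<open>r = 1\<close>, the empty set is its own neighbour,
  in accordance with the degree \<open>card X choose 0\<close>.\<close>

definition disjoint_sum :: "'a set \<Rightarrow> nat \<Rightarrow> ('a set \<Rightarrow> real) \<Rightarrow> 'a set \<Rightarrow> real" where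
  "disjoint_sum X k f S = (\<Sum>T\<in>ksubsets (X - S) k. f T)"

lemma finite_ksubsets: "finite X \<Longrightarrow> finite (ksubsets X k)"
  by (simp add: ksubsets_def)

lemma finite_if_in_ksubsets: "S \<in> ksubsets X k \<Longrightarrow> finite X \<Longrightarrow> finite S"
  by (auto simp: ksubsets_def dest: finite_subset)

lemma card_ksubsets: "finite X \<Longrightarrow> card (ksubsets X k) = card X choose k"
  by (simp add: ksubsets_def n_subsets)

lemma ksubset_exists:
  assumes "k \<le> card X"
  obtains S where "S \<in> ksubsets X k"
  using assms obtain_subset_with_card_n[of k X] unfolding ksubsets_def by blast

lemma insert_in_ksubsets:
  assumes "finite X" "R \<in> ksubsets X k" "x \<notin> R" "x \<in> Y" "X \<subseteq> Y"
  shows "insert x R \<in> ksubsets Y (Suc k)"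
  using assms finite_subset[of R X] by (auto simp: ksubsets_def)

text \<open>Pascal's rule for sums: the subsets are split according to whether they contain
  \<open>y\<close>.\<close>

lemma sum_ksubsets_insert:
  fixes f :: "'a set \<Rightarrow> real"
  assumes Y: "finite Y" and y: "y \<notin> Y"
  shows "(\<Sum>T\<in>ksubsets (insert y Y) (Suc k). f T)
    = (\<Sum>T\<in>ksubsets Y (Suc k). f T) + (\<Sum>T\<in>ksubsets Y k. f (insert y T))"
proof -
  have eq: "ksubsets (insert y Y) (Suc k) = ksubsets Y (Suc k) \<union> insert y ` ksubsets Y k"
  proof (intro equalityI subsetI)
    fix T assume T: "T \<in> ksubsets (insert y Y) (Suc k)"
    show "T \<in> ksubsets Y (Suc k) \<union> insert y ` ksubsets Y k"
    proof (cases "y \<in> T")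
      case True
      then have "T = insert y (T - {y})" "T - {y} \<in> ksubsets Y k"
        using T by (auto simp: ksubsets_def)
      then show ?thesis by blast
    qed (use T in \<open>auto simp: ksubsets_def\<close>)
  next
    fix T assume "T \<in> ksubsets Y (Suc k) \<union> insert y ` ksubsets Y k"
    then show "T \<in> ksubsets (insert y Y) (Suc k)"
      using insert_in_ksubsets[OF Y, of _ k y "insert y Y"] y by (auto simp: ksubsets_def)
  qed
  have inj: "inj_on (insert y) (ksubsets Y k)"
    using y by (auto simp: ksubsets_def inj_on_def)
  have "ksubsets Y (Suc k) \<inter> insert y ` ksubsets Y k = {}"
    using y by (auto simp: ksubsets_def)
  then show ?thesis
    unfolding eq using Y by (simp add: sum.union_disjoint finite_ksubsets sum.reindex[OF inj])
qed

text \<open>The swap difference \<open>f (S + x) - f (S + y)\<close> intertwines the Kneser adjacency operators of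
  \<open>(X, k + 1)\<close> and \<open>(X - {x, y}, k)\<close>, up to a sign.\<close>

lemma disjoint_sum_swap:
  assumes X: "finite X" and xy: "x \<in> X" "y \<in> X" "x \<noteq> y" and S: "S \<subseteq> X - {x, y}"
  shows "disjoint_sum (X - {x, y}) k (\<lambda>T. f (insert x T) - f (insert y T)) S
    = - (disjoint_sum X (Suc k) f (insert x S) - disjoint_sum X (Suc k) f (insert y S))"
proof -
  define Y where "Y = X - {x, y} - S"
  have Y: "finite Y" "x \<notin> Y" "y \<notin> Y" using X by (auto simp: Y_def)
  \<comment> \<open>A neighbour of \<open>S + x\<close> may contain \<open>y\<close> but not
    \<open>x\<close>, and conversely. The neighbours inside \<open>Y\<close> cancel, and the
    exchanged roles of \<open>x\<close> and \<open>y\<close> give the minus sign.\<close>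
  have "X - insert x S = insert y Y" "X - insert y S = insert x Y"
    using xy S by (auto simp: Y_def)
  then show ?thesis
    unfolding disjoint_sum_def Y_def[symmetric]
    using sum_ksubsets_insert[OF Y(1,3), of f k] sum_ksubsets_insert[OF Y(1,2), of f k]
    by (simp add: sum_subtractf)
qed

text \<open>With an index set independent of \<open>S\<close>, double sums can be interchanged and
  compared with matrix products.\<close>

lemma disjoint_sum_filter:
  assumes "finite X" "S \<subseteq> X"
  shows "disjoint_sum X k f S = (\<Sum>T\<in>ksubsets X k. if S \<inter> T = {} then f T else 0)"
proof -
  have "ksubsets (X - S) k = {T \<in> ksubsets X k. S \<inter> T = {}}"
    using assms by (auto simp: ksubsets_def)
  then show ?thesis
    using assms by (simp add: disjoint_sum_def sum.inter_filter finite_ksubsets)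
qed

lemma disjoint_sum_const:
  assumes "finite X" "S \<in> ksubsets X k"
  shows "disjoint_sum X k (\<lambda>_. c) S = real (card X - k choose k) * c"
  using assms finite_subset[of S X]
  by (auto simp: disjoint_sum_def card_ksubsets ksubsets_def[of X] card_Diff_subset)

text \<open>This is the Laplacian form over ordered edges. After expanding the square, both pure
  squares contribute the degree times the squared norm, since disjointness is symmetric and the
  graph is regular.\<close>

lemma disjoint_sum_laplacian:
  assumes X: "finite X"
  shows "(\<Sum>S\<in>ksubsets X k. disjoint_sum X k (\<lambda>T. (g S - g T)^2) S)
    = 2 * (real (card X - k choose k) * (\<Sum>S\<in>ksubsets X k. (g S)^2)
        - (\<Sum>S\<in>ksubsets X k. g S * disjoint_sum X k g S))"
proof -
  define V where "V = ksubsets X k"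
  define d where "d = real (card X - k choose k)"
  have deg: "disjoint_sum X k (\<lambda>_. c) S = d * c" if "S \<in> V" for S c
    using disjoint_sum_const[OF X] that by (simp add: V_def d_def)
  have flt: "disjoint_sum X k f S = (\<Sum>T\<in>V. if S \<inter> T = {} then f T else 0)" if "S \<in> V" for f S
    unfolding V_def by (rule disjoint_sum_filter[OF X]) (use that in \<open>auto simp: V_def ksubsets_def\<close>)
  have "(\<Sum>S\<in>V. disjoint_sum X k (\<lambda>T. (g T)^2) S)
      = (\<Sum>S\<in>V. \<Sum>T\<in>V. if S \<inter> T = {} then (g T)^2 else 0)"
    by (simp add: flt)
  also have "\<dots> = (\<Sum>T\<in>V. \<Sum>S\<in>V. if T \<inter> S = {} then (g T)^2 else 0)"
    by (subst sum.swap) (simp add: Int_commute)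
  also have "\<dots> = (\<Sum>T\<in>V. d * (g T)^2)"
    by (intro sum.cong) (simp_all add: deg[symmetric] flt)
  finally have sw: "(\<Sum>S\<in>V. disjoint_sum X k (\<lambda>T. (g T)^2) S) = d * (\<Sum>T\<in>V. (g T)^2)"
    by (simp add: sum_distrib_left)
  have "disjoint_sum X k (\<lambda>T. (g S - g T)^2) S
      = d * (g S)^2 + disjoint_sum X k (\<lambda>T. (g T)^2) S - 2 * (g S * disjoint_sum X k g S)"
    if "S \<in> V" for S
    unfolding deg[OF that, symmetric]
    by (simp add: disjoint_sum_def power2_diff sum_subtractf sum.distrib sum_distrib_left
        algebra_simps)
  then have "(\<Sum>S\<in>V. disjoint_sum X k (\<lambda>T. (g S - g T)^2) S)
      = (\<Sum>S\<in>V. d * (g S)^2 + disjoint_sum X k (\<lambda>T. (g T)^2) S - 2 * (g S * disjoint_sum X k g S))"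
    by simp
  also have "\<dots> = d * (\<Sum>S\<in>V. (g S)^2) + d * (\<Sum>S\<in>V. (g S)^2)
      - 2 * (\<Sum>S\<in>V. g S * disjoint_sum X k g S)"
    by (simp add: sum_subtractf sum.distrib sw sum_distrib_left)
  finally show ?thesis by (simp add: V_def d_def)
qed

text \<open>Together with the identity above, this bounds the eigenvalues by the degree.\<close>

lemma disjoint_sum_laplacian_nonneg:
  "0 \<le> (\<Sum>S\<in>ksubsets X k. disjoint_sum X k (\<lambda>T. (g S - g T)^2) S)"
  unfolding disjoint_sum_def by (intro sum_nonneg) auto

text \<open>Exchanging an element of \<open>S - T\<close> for one of \<open>T - S\<close> lowers
  \<open>card (S - T)\<close> by one, so sets of equal size are linked by such exchanges.\<close>

lemma swap_invariant_const:
  assumes X: "finite X"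
    and swap: "\<And>R a b. a \<in> X \<Longrightarrow> b \<in> X \<Longrightarrow> a \<noteq> b \<Longrightarrow> R \<subseteq> X - {a, b} \<Longrightarrow> Suc (card R) = k
      \<Longrightarrow> g (insert a R) = g (insert b R)"
    and "S \<in> ksubsets X k" "T \<in> ksubsets X k"
  shows "g S = g T"
  using assms(3)
proof (induction "card (S - T)" arbitrary: S)
  case 0
  have fin: "finite S" "finite T"
    using 0 assms(4) X by (auto intro: finite_if_in_ksubsets)
  then have "S \<subseteq> T" using 0 by simp
  then have "S = T" using 0 assms(4) fin card_subset_eq[of T S] by (auto simp: ksubsets_def)
  then show ?case by simp
next
  case (Suc m)
  have fin: "finite S" "finite T" and sub: "S \<subseteq> X" "T \<subseteq> X" and card: "card S = k" "card T = k"
    using Suc.prems assms(4) X finite_if_in_ksubsets[of S X k] finite_if_in_ksubsets[of T X k]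
    by (auto simp: ksubsets_def)
  have "card (T - S) = card (S - T)"
    using fin card by (metis card_Diff_subset_Int finite_Int Int_commute)
  then have "card (T - S) \<noteq> 0" "card (S - T) \<noteq> 0" using Suc.hyps(2) by auto
  then obtain a b where a: "a \<in> S" "a \<notin> T" and b: "b \<in> T" "b \<notin> S"
    using fin by (metis card_0_eq finite_Diff DiffE all_not_in_conv)
  define R where "R = S - {a}"
  have R: "finite R" "a \<notin> R" "b \<notin> R" "S = insert a R" "Suc (card R) = k"
    using a b fin card card_Suc_Diff1[OF fin(1) a(1)] by (auto simp: R_def)
  have "g S = g (insert b R)"
    unfolding R(4) by (rule swap) (use R a b sub in auto)
  also have "\<dots> = g T"
  proof (rule Suc.hyps(1))
    have "insert b R - T = (S - T) - {a}" using a b by (auto simp: R_def)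
    then show "m = card (insert b R - T)" using Suc.hyps(2) a fin by simp
    show "insert b R \<in> ksubsets X k" using R b sub by (auto simp: ksubsets_def)
  qed
  finally show ?case .
qed

text \<open>Connectedness of the Kneser graph: two sets differing in a single element have a common
  neighbour.\<close>

lemma disjoint_invariant_const:
  assumes X: "finite X" "2 * k + 1 \<le> card X"
    and disj: "\<And>S T. S \<in> ksubsets X k \<Longrightarrow> T \<in> ksubsets X k \<Longrightarrow> S \<inter> T = {} \<Longrightarrow> g S = g T"
    and ST: "S \<in> ksubsets X k" "T \<in> ksubsets X k"
  shows "g S = g T"
proof (rule swap_invariant_const[OF X(1) _ ST])
  fix R a b
  assume ab: "a \<in> X" "b \<in> X" "a \<noteq> b" "R \<subseteq> X - {a, b}" "Suc (card R) = k"
  have fin: "finite R" using ab(4) X(1) by (auto dest: finite_subset)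
  have in_X: "insert c R \<in> ksubsets X k" if "c = a \<or> c = b" for c
  proof -
    have "c \<notin> R" using that ab by auto
    then show ?thesis using that ab fin by (auto simp: ksubsets_def)
  qed
  \<comment> \<open>The union of the two sets has \<open>k + 1\<close> elements, so at least
    \<open>k\<close> remain for the common neighbour \<open>U\<close>.\<close>
  have "card (X - insert a (insert b R)) = card X - Suc (Suc (card R))"
  proof -
    have "a \<notin> R" "b \<notin> R" using ab by auto
    then show ?thesis using ab fin by (subst card_Diff_subset) auto
  qed
  then obtain U where U: "U \<in> ksubsets (X - insert a (insert b R)) k"
    using X(2) ab(5) by (auto intro: ksubset_exists[of k "X - insert a (insert b R)"])
  then have U': "U \<in> ksubsets X k" by (auto simp: ksubsets_def)
  have "g (insert a R) = g U" by (rule disj) (use in_X U U' in \<open>auto simp: ksubsets_def\<close>)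
  moreover have "g (insert b R) = g U" by (rule disj) (use in_X U U' in \<open>auto simp: ksubsets_def\<close>)
  ultimately show "g (insert a R) = g (insert b R)" by simp
qed

text \<open>When the eigenvalue equals the degree, the Laplacian form is zero; each of its squares
  vanishes, \<open>g\<close> agrees along edges, and connectedness finishes.\<close>

lemma disjoint_sum_extremal_const:
  assumes X: "finite X" "2 * k + 1 \<le> card X"
    and ext: "\<And>S. S \<in> ksubsets X k \<Longrightarrow> disjoint_sum X k g S = real (card X - k choose k) * g S"
    and ST: "S \<in> ksubsets X k" "T \<in> ksubsets X k"
  shows "g S = g T"
proof (rule disjoint_invariant_const[OF X _ ST])
  fix S T assume S: "S \<in> ksubsets X k" and T: "T \<in> ksubsets X k" and ST: "S \<inter> T = {}"
  have "(\<Sum>S\<in>ksubsets X k. disjoint_sum X k (\<lambda>T. (g S - g T)^2) S) = 0"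
    unfolding disjoint_sum_laplacian[OF X(1)]
    by (simp add: ext sum_distrib_left power2_eq_square algebra_simps)
  then have "\<forall>S\<in>ksubsets X k. disjoint_sum X k (\<lambda>T. (g S - g T)^2) S = 0"
    by (subst (asm) sum_nonneg_eq_0_iff) (auto simp: X finite_ksubsets disjoint_sum_def intro: sum_nonneg)
  then have "(\<Sum>T\<in>ksubsets (X - S) k. (g S - g T)^2) = 0"
    using S by (simp add: disjoint_sum_def)
  then have "\<forall>T\<in>ksubsets (X - S) k. (g S - g T)^2 = 0"
    by (subst (asm) sum_nonneg_eq_0_iff) (auto simp: X finite_ksubsets)
  moreover have "T \<in> ksubsets (X - S) k" using T ST by (auto simp: ksubsets_def)
  ultimately show "g S = g T" by simp
qed

section \<open>The shifted Kneser matrix: positivity and kernel\<close>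

text \<open>Here \<open>k\<close> is the subset size after a swap pair is removed, and
  \<open>d\<close> is the degree of the Kneser graph of \<open>k\<close>-subsets of the remaining
  \<open>card X - 2\<close> points.\<close>

locale kneser =
  fixes X :: "'a set" and r k :: nat and d :: real
  assumes finX: "finite X" and r: "r = Suc k" and cardX: "2 * r + 1 \<le> card X"
    and d: "d = real (card X - r - 1 choose k)"
begin

text \<open>The Kneser adjacency matrix shifted by its least eigenvalue \<open>- d\<close>.\<close>

definition M :: "'a set \<Rightarrow> 'a set \<Rightarrow> real" where
  "M S T = of_bool (S \<inter> T = {}) + d * of_bool (S = T)"

abbreviation V :: "'a set set" where "V \<equiv> ksubsets X r"

lemma finV: "finite V" by (rule finite_ksubsets[OF finX])

lemma M_sym: "M S T = M T S" by (auto simp: M_def Int_commute)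

lemma apply_M:
  assumes "S \<in> V"
  shows "apply_mat M V f S = disjoint_sum X r f S + d * f S"
proof -
  have "apply_mat M V f S = (\<Sum>T\<in>V. (if S \<inter> T = {} then f T else 0) + (if T = S then d * f S else 0))"
    unfolding apply_mat_def M_def by (rule sum.cong) (auto simp: algebra_simps)
  also have "\<dots> = (\<Sum>T\<in>V. if S \<inter> T = {} then f T else 0) + d * f S"
    using finV assms by (simp add: sum.distrib)
  finally show ?thesis
    using assms by (subst disjoint_sum_filter[OF finX]) (auto simp: ksubsets_def)
qed

lemma swap_facts:
  assumes "x \<in> X" "y \<in> X" "x \<noteq> y"
  shows "finite (X - {x, y})" "2 * k + 1 \<le> card (X - {x, y})"
    "d = real (card (X - {x, y}) - k choose k)"
    and "S \<in> ksubsets (X - {x, y}) k \<Longrightarrow> insert x S \<in> V \<and> insert y S \<in> V"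
proof -
  have "card (X - {x, y}) = card X - 2"
    using assms finX by (subst card_Diff_subset) auto
  then show "2 * k + 1 \<le> card (X - {x, y})" "d = real (card (X - {x, y}) - k choose k)"
    using cardX r d by auto
  show fin: "finite (X - {x, y})" using finX by simp
  show "insert x S \<in> V \<and> insert y S \<in> V" if "S \<in> ksubsets (X - {x, y}) k"
    unfolding r using insert_in_ksubsets[OF fin that, of _ X] assms that
    by (auto simp: ksubsets_def)
qed

text \<open>Eigenvalue \<open>l\<close> of \<open>M\<close> is eigenvalue \<open>l - d\<close> of
  the adjacency operator, and passing to swap differences reverses the sign.\<close>

lemma swap_eigen:
  assumes eig: "\<forall>S\<in>V. apply_mat M V f S = l * f S"
    and xy: "x \<in> X" "y \<in> X" "x \<noteq> y" and S: "S \<in> ksubsets (X - {x, y}) k"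
  shows "disjoint_sum (X - {x, y}) k (\<lambda>T. f (insert x T) - f (insert y T)) S
    = (d - l) * (f (insert x S) - f (insert y S))"
proof -
  have V: "insert x S \<in> V" "insert y S \<in> V" using swap_facts(4)[OF xy S] by auto
  have "disjoint_sum X r f (insert z S) = (l - d) * f (insert z S)" if "insert z S \<in> V" for z
    using eig apply_M[OF that, of f] that by (simp add: algebra_simps)
  from this[OF V(1)] this[OF V(2)] show ?thesis
    using disjoint_sum_swap[OF finX xy, of S k f] S
    unfolding r by (simp add: ksubsets_def[of "X - {x, y}"]) (simp add: algebra_simps)
qed

text \<open>A negative \<open>l\<close> would give the swap differences the eigenvalue
  \<open>d - l\<close>, above the degree \<open>d\<close>. So they vanish and \<open>f\<close> is
  constant, but then \<open>l\<close> is the degree of the large graph plus \<open>d\<close>, which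
  is not negative.\<close>

lemma eigenvalue_nonneg:
  assumes nz: "\<exists>S\<in>V. f S \<noteq> 0" and eig: "\<forall>S\<in>V. apply_mat M V f S = l * f S"
  shows "0 \<le> l"
proof (rule ccontr)
  assume l: "\<not> 0 \<le> l"
  have swap: "f (insert x S) = f (insert y S)"
    if xy: "x \<in> X" "y \<in> X" "x \<noteq> y" and S: "S \<in> ksubsets (X - {x, y}) k" for x y S
  proof -
    define Y where "Y = ksubsets (X - {x, y}) k"
    define g where "g = (\<lambda>S. f (insert x S) - f (insert y S))"
    have fin: "finite Y" using finX by (simp add: Y_def finite_ksubsets)
    have g: "disjoint_sum (X - {x, y}) k g S = (d - l) * g S" if "S \<in> Y" for S
      using swap_eigen[OF eig xy] that by (simp add: Y_def g_def)
    have "0 \<le> d * (\<Sum>S\<in>Y. (g S)^2) - (\<Sum>S\<in>Y. g S * disjoint_sum (X - {x, y}) k g S)"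
      using disjoint_sum_laplacian_nonneg[of "X - {x, y}" k g]
      unfolding disjoint_sum_laplacian[OF swap_facts(1)[OF xy]] swap_facts(3)[OF xy, symmetric]
      by (simp add: Y_def)
    also have "\<dots> = l * (\<Sum>S\<in>Y. (g S)^2)"
      by (simp add: g sum_distrib_left power2_eq_square algebra_simps sum_subtractf)
    finally have "(\<Sum>S\<in>Y. (g S)^2) = 0"
      using l sum_nonneg[of Y "\<lambda>S. (g S)^2"] by (auto simp: zero_le_mult_iff)
    then have "\<forall>S\<in>Y. g S = 0" using fin by (simp add: sum_nonneg_eq_0_iff)
    then show ?thesis using S by (simp add: Y_def g_def)
  qed
  obtain S where S: "S \<in> V" "f S \<noteq> 0" using nz by blast
  have const: "f T = f S" if "T \<in> V" for T
  proof (rule swap_invariant_const[OF finX _ that S(1)])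
    fix R a b
    assume "a \<in> X" "b \<in> X" "a \<noteq> b" "R \<subseteq> X - {a, b}" "Suc (card R) = r"
    then show "f (insert a R) = f (insert b R)"
      using swap[of a b R] r by (simp add: ksubsets_def)
  qed
  have "disjoint_sum X r f S = disjoint_sum X r (\<lambda>_. f S) S"
    unfolding disjoint_sum_def by (intro sum.cong refl const) (auto simp: ksubsets_def)
  also have "\<dots> = real (card X - r choose r) * f S" by (rule disjoint_sum_const[OF finX S(1)])
  finally have "l * f S = (real (card X - r choose r) + d) * f S"
    using eig S(1) apply_M[OF S(1), of f] by (simp add: algebra_simps)
  then have "l = real (card X - r choose r) + d" using S(2) by simp
  then show False using l d by simp
qed

lemma M_psd: "0 \<le> quad_form M V f"
  by (rule psd_if_eigenvalues_nonneg[OF finV M_sym eigenvalue_nonneg])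

text \<open>For \<open>l = 0\<close> the swap differences have the degree as eigenvalue, hence are
  constant. They are written as \<open>c x - c y\<close>; subtracting \<open>sum c S\<close> from
  \<open>f S\<close> then leaves a swap-invariant, hence constant, function.\<close>

lemma kernel_linear:
  assumes ker: "\<forall>S\<in>V. apply_mat M V f S = 0"
  shows "\<exists>a. \<forall>S\<in>V. f S = sum a S"
proof -
  have eig: "\<forall>S\<in>V. apply_mat M V f S = 0 * f S" using ker by simp
  have const: "f (insert x S) - f (insert y S) = f (insert x T) - f (insert y T)"
    if xy: "x \<in> X" "y \<in> X" "x \<noteq> y"
      and S: "S \<in> ksubsets (X - {x, y}) k" and T: "T \<in> ksubsets (X - {x, y}) k" for x y S T
  proof (rule disjoint_sum_extremal_const[OF swap_facts(1,2)[OF xy] _ S T])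
    show "disjoint_sum (X - {x, y}) k (\<lambda>S. f (insert x S) - f (insert y S)) S
      = real (card (X - {x, y}) - k choose k) * (f (insert x S) - f (insert y S))"
      if "S \<in> ksubsets (X - {x, y}) k" for S
      using swap_eigen[OF eig xy that] swap_facts(3)[OF xy] by simp
  qed
  obtain z where z: "z \<in> X" using cardX by fastforce
  \<comment> \<open>The base point \<open>z\<close> gets weight 0, and any other \<open>x\<close>
    the constant swap difference against \<open>z\<close>; by \<open>const\<close> the chosen
    \<open>R\<close> does not matter.\<close>
  define c where "c = (\<lambda>x. if x = z then 0 else
    let R = (SOME R. R \<in> ksubsets (X - {x, z}) k) in f (insert x R) - f (insert z R))"
  have c: "f (insert x R) - f (insert z R) = c x"
    if "x \<in> X" "x \<noteq> z" "R \<in> ksubsets (X - {x, z}) k" for x R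
  proof -
    have "(SOME R. R \<in> ksubsets (X - {x, z}) k) \<in> ksubsets (X - {x, z}) k"
      using that(3) by (rule someI)
    then show ?thesis using const[OF that(1) z that(2) that(3)] that(2) by (simp add: c_def Let_def)
  qed
  have diff: "f (insert x R) - f (insert y R) = c x - c y"
    if xy: "x \<in> X" "y \<in> X" "x \<noteq> y" and R: "R \<in> ksubsets (X - {x, y}) k" for x y R
  proof -
    consider "x = z" | "y = z" | "x \<noteq> z" "y \<noteq> z" by blast
    then show ?thesis
    proof cases
      case 1
      then have "X - {x, y} = X - {y, z}" by auto
      with 1 show ?thesis using c[of y R] xy R by (simp add: c_def)
    next
      case 2
      then show ?thesis using c[of x R] xy R by (simp add: c_def)
    next
      case 3
      \<comment> \<open>A set \<open>U\<close> avoiding all three points lets the difference for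
        \<open>x\<close>, \<open>y\<close> be split through \<open>z\<close>.\<close>
      have "card (X - {x, y, z}) = card X - 3"
        using xy z 3 finX by (subst card_Diff_subset) auto
      then obtain U where U: "U \<in> ksubsets (X - {x, y, z}) k"
        using cardX r by (auto intro: ksubset_exists[of k "X - {x, y, z}"])
      have "f (insert x R) - f (insert y R) = f (insert x U) - f (insert y U)"
        by (rule const[OF xy R]) (use U in \<open>auto simp: ksubsets_def\<close>)
      also have "\<dots> = (f (insert x U) - f (insert z U)) - (f (insert y U) - f (insert z U))" by simp
      also have "\<dots> = c x - c y"
        using c[of x U] c[of y U] 3 xy U by (simp add: ksubsets_def subset_iff)
      finally show ?thesis .
    qed
  qed
  have inv: "f S - sum c S = f T - sum c T" if "S \<in> V" "T \<in> V" for S T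
  proof (rule swap_invariant_const[OF finX _ that])
    fix R a b
    assume ab: "a \<in> X" "b \<in> X" "a \<noteq> b" "R \<subseteq> X - {a, b}" "Suc (card R) = r"
    then have R: "finite R" "a \<notin> R" "b \<notin> R" "R \<in> ksubsets (X - {a, b}) k"
      using finX r by (auto simp: ksubsets_def dest: finite_subset)
    show "f (insert a R) - sum c (insert a R) = f (insert b R) - sum c (insert b R)"
      using diff[OF ab(1,2,3) R(4)] R by simp
  qed
  obtain S0 where S0: "S0 \<in> V" using cardX by (auto intro: ksubset_exists[of r X])
  \<comment> \<open>The remaining constant is spread evenly over the \<open>r\<close> elements of
    each set.\<close>
  define e where "e = (f S0 - sum c S0) / real r"
  have "f S = (\<Sum>x\<in>S. c x + e)" if "S \<in> V" for S
    using inv[OF that S0] that r by (simp add: sum.distrib e_def ksubsets_def)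
  then show ?thesis by blast
qed

end

section \<open>Linear and bilinear sums vanishing on subsets of fixed size\<close>

text \<open>Comparing \<open>R + x\<close> with \<open>R + y\<close> shows that \<open>b\<close> is
  constant on \<open>X\<close>, and then a single sum is \<open>r\<close> times its value.\<close>

lemma sum_ksubsets_zero:
  fixes b :: "'a \<Rightarrow> real"
  assumes X: "finite X" and r: "0 < r" "r < card X"
    and zero: "\<And>S. S \<in> ksubsets X r \<Longrightarrow> sum b S = 0" and x: "x \<in> X"
  shows "b x = 0"
proof -
  have eq: "b y = b x" if "y \<in> X" for y
  proof (cases "y = x")
    case False
    have "card (X - {x, y}) = card X - 2" using False x that X by (subst card_Diff_subset) auto
    then obtain R where R: "R \<in> ksubsets (X - {x, y}) (r - 1)"
      using r by (auto intro: ksubset_exists[of "r - 1" "X - {x, y}"])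
    then have "finite R" "x \<notin> R" "y \<notin> R" using X by (auto simp: ksubsets_def dest: finite_subset)
    moreover have "insert z R \<in> ksubsets X r" if "z = x \<or> z = y" for z
      using insert_in_ksubsets[of "X - {x, y}" R "r - 1" z X] R that calculation x \<open>y \<in> X\<close> X r by auto
    ultimately show ?thesis using zero[of "insert x R"] zero[of "insert y R"] by simp
  qed simp
  obtain S where S: "S \<in> ksubsets X r" using r by (auto intro: ksubset_exists[of r X])
  have "sum b S = real r * b x" using S eq by (simp add: ksubsets_def subset_iff)
  then show ?thesis using zero[OF S] r by simp
qed

text \<open>The linear case is applied three times: in \<open>T\<close> within \<open>X - S\<close>,
  which has more than \<open>r\<close> elements; then in \<open>S\<close> within
  \<open>X - {j}\<close>, which kills the off-diagonal entries; then to the diagonal.\<close>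

lemma bilinear_ksubsets_zero:
  fixes B :: "'a \<Rightarrow> 'a \<Rightarrow> real"
  assumes X: "finite X" and r: "0 < r" "2 * r < card X"
    and disj: "\<And>S T. S \<in> ksubsets X r \<Longrightarrow> T \<in> ksubsets X r \<Longrightarrow> S \<inter> T = {}
      \<Longrightarrow> (\<Sum>i\<in>S. \<Sum>j\<in>T. B i j) = 0"
    and diag: "\<And>S. S \<in> ksubsets X r \<Longrightarrow> (\<Sum>i\<in>S. \<Sum>j\<in>S. B i j) = 0"
    and ij: "i \<in> X" "j \<in> X"
  shows "B i j = 0"
proof -
  have row: "(\<Sum>i\<in>S. B i j) = 0" if S: "S \<in> ksubsets X r" and j: "j \<in> X - S" for S j
  proof (rule sum_ksubsets_zero[OF _ r(1) _ _ j])
    show "finite (X - S)" using X by simp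
    have "card (X - S) = card X - r"
      using S X finite_if_in_ksubsets[OF S X] by (simp add: ksubsets_def card_Diff_subset)
    then show "r < card (X - S)" using r by simp
    fix T assume T: "T \<in> ksubsets (X - S) r"
    have "(\<Sum>j\<in>T. \<Sum>i\<in>S. B i j) = (\<Sum>i\<in>S. \<Sum>j\<in>T. B i j)" by (rule sum.swap)
    also have "\<dots> = 0" using T by (intro disj S) (auto simp: ksubsets_def)
    finally show "(\<Sum>j\<in>T. \<Sum>i\<in>S. B i j) = 0" .
  qed
  have off: "B i j = 0" if "i \<in> X" "j \<in> X" "i \<noteq> j" for i j
  proof (rule sum_ksubsets_zero[of "X - {j}" r "\<lambda>i. B i j"])
    show "sum (\<lambda>i. B i j) S = 0" if "S \<in> ksubsets (X - {j}) r" for S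
      by (rule row) (use that \<open>j \<in> X\<close> in \<open>auto simp: ksubsets_def\<close>)
  qed (use X r that in auto)
  have "B i i = 0"
  proof (rule sum_ksubsets_zero[of X r "\<lambda>i. B i i"])
    fix S assume S: "S \<in> ksubsets X r"
    then have fin: "finite S" and sub: "S \<subseteq> X" using X finite_if_in_ksubsets by (auto simp: ksubsets_def)
    have "(\<Sum>i\<in>S. \<Sum>j\<in>S. B i j) = (\<Sum>i\<in>S. \<Sum>j\<in>S. if j = i then B i i else 0)"
      using sub by (intro sum.cong refl) (auto intro!: off)
    then show "(\<Sum>i\<in>S. B i i) = 0" using diag[OF S] fin by simp
  qed (use X r ij in auto)
  with off ij show ?thesis by blast
qed

section \<open>Uniqueness of the Gram matrix\<close>

lemma scalar_prod_lessThan: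
  "scalar_prod u (v :: real vec) = (\<Sum>k<dim_vec v. u $ k * v $ k)"
  by (simp add: scalar_prod_def atLeast0LessThan)

context kneser
begin

text \<open>Both sides are the trace of \<open>M\<close> times the Gram matrix of \<open>w\<close>;
  the left one is computed coordinate by coordinate.\<close>

lemma quad_form_gram:
  assumes "\<And>S. S \<in> V \<Longrightarrow> w S \<in> carrier_vec e"
  shows "(\<Sum>j<e. quad_form M V (\<lambda>S. w S $ j)) = (\<Sum>S\<in>V. \<Sum>T\<in>V. M S T * scalar_prod (w S) (w T))"
proof -
  have "(\<Sum>j<e. quad_form M V (\<lambda>S. w S $ j))
      = (\<Sum>j<e. \<Sum>S\<in>V. \<Sum>T\<in>V. M S T * (w S $ j * w T $ j))"
    by (simp add: quad_form_def apply_mat_def sum_distrib_left algebra_simps)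
  also have "\<dots> = (\<Sum>S\<in>V. \<Sum>j<e. \<Sum>T\<in>V. M S T * (w S $ j * w T $ j))" by (rule sum.swap)
  also have "\<dots> = (\<Sum>S\<in>V. \<Sum>T\<in>V. \<Sum>j<e. M S T * (w S $ j * w T $ j))"
    by (intro sum.cong refl) (rule sum.swap)
  also have "\<dots> = (\<Sum>S\<in>V. \<Sum>T\<in>V. M S T * scalar_prod (w S) (w T))"
    using carrier_vecD[OF assms] by (intro sum.cong refl) (simp add: scalar_prod_lessThan sum_distrib_left)
  finally show ?thesis .
qed

text \<open>Each coordinate is additive over the elements of \<open>S\<close> by
  \<open>kernel_linear\<close>; \<open>B\<close> is the Gram matrix of the vectors attached to the
  elements.\<close>

lemma gram_linear:
  assumes w: "\<And>S. S \<in> V \<Longrightarrow> w S \<in> carrier_vec e"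
    and ker: "\<And>j. j < e \<Longrightarrow> \<forall>S\<in>V. apply_mat M V (\<lambda>S. w S $ j) S = 0"
  shows "\<exists>B. \<forall>S\<in>V. \<forall>T\<in>V. scalar_prod (w S) (w T) = (\<Sum>i\<in>S. \<Sum>j\<in>T. B i j)"
proof -
  have "\<forall>j. \<exists>a. j < e \<longrightarrow> (\<forall>S\<in>V. w S $ j = sum a S)"
    using kernel_linear[OF ker] by blast
  then obtain a where a: "\<And>j S. j < e \<Longrightarrow> S \<in> V \<Longrightarrow> w S $ j = sum (a j) S" by metis
  have "scalar_prod (w S) (w T) = (\<Sum>x\<in>S. \<Sum>y\<in>T. \<Sum>j<e. a j x * a j y)"
    if S: "S \<in> V" and T: "T \<in> V" for S T
  proof -
    have "scalar_prod (w S) (w T) = (\<Sum>j<e. sum (a j) S * sum (a j) T)"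
      using w[OF T] a S T by (simp add: scalar_prod_lessThan)
    also have "\<dots> = (\<Sum>j<e. \<Sum>x\<in>S. \<Sum>y\<in>T. a j x * a j y)" by (simp add: sum_product)
    also have "\<dots> = (\<Sum>x\<in>S. \<Sum>j<e. \<Sum>y\<in>T. a j x * a j y)" by (rule sum.swap)
    also have "\<dots> = (\<Sum>x\<in>S. \<Sum>y\<in>T. \<Sum>j<e. a j x * a j y)"
      by (intro sum.cong refl) (rule sum.swap)
    finally show ?thesis .
  qed
  then show ?thesis by (intro exI[of _ "\<lambda>x y. \<Sum>j<e. a j x * a j y"]) blast
qed

text \<open>Complementary slackness: the trace of \<open>M\<close> against the Gram matrix of
  \<open>q\<close> is at most 0 by comparison with \<open>p\<close> and at least 0 by positivity.
  Equality gives both the kernel condition for \<open>q\<close> and equality on edges.\<close>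

lemma gram_unique:
  assumes p: "\<And>S. S \<in> V \<Longrightarrow> p S \<in> carrier_vec m"
    and q: "\<And>S. S \<in> V \<Longrightarrow> q S \<in> carrier_vec e"
    and ker: "\<And>j. j < m \<Longrightarrow> \<forall>S\<in>V. apply_mat M V (\<lambda>S. p S $ j) S = 0"
    and diag: "\<And>S. S \<in> V \<Longrightarrow> scalar_prod (q S) (q S) = scalar_prod (p S) (p S)"
    and edge: "\<And>S T. S \<in> V \<Longrightarrow> T \<in> V \<Longrightarrow> S \<inter> T = {}
      \<Longrightarrow> scalar_prod (q S) (q T) \<le> scalar_prod (p S) (p T)"
    and ST: "S \<in> V" "T \<in> V"
  shows "scalar_prod (q S) (q T) = scalar_prod (p S) (p T)"
proof -
  \<comment> \<open>The support of \<open>M\<close> lies in the diagonal and the disjoint pairs,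
    exactly where the two Gram matrices are compared.\<close>
  have le: "M S T * scalar_prod (q S) (q T) \<le> M S T * scalar_prod (p S) (p T)"
    if "S \<in> V" "T \<in> V" for S T
  proof -
    consider "S = T" | "S \<noteq> T" "S \<inter> T = {}" | "S \<noteq> T" "S \<inter> T \<noteq> {}" by blast
    then show ?thesis by cases (use that edge diag in \<open>auto simp: M_def\<close>)
  qed
  have p0: "(\<Sum>S\<in>V. \<Sum>T\<in>V. M S T * scalar_prod (p S) (p T)) = 0"
    using quad_form_gram[of p m] p ker by (simp add: quad_form_def)
  have "(\<Sum>S\<in>V. \<Sum>T\<in>V. M S T * scalar_prod (q S) (q T)) \<le> 0"
    unfolding p0[symmetric] by (intro sum_mono le)
  moreover have nonneg: "0 \<le> (\<Sum>j<e. quad_form M V (\<lambda>S. q S $ j))"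
    by (intro sum_nonneg M_psd)
  ultimately have q0: "(\<Sum>S\<in>V. \<Sum>T\<in>V. M S T * scalar_prod (q S) (q T)) = 0"
    and "(\<Sum>j<e. quad_form M V (\<lambda>S. q S $ j)) = 0"
    using quad_form_gram[OF q] by auto
  then have "\<forall>j<e. quad_form M V (\<lambda>S. q S $ j) = 0"
    by (subst (asm) sum_nonneg_eq_0_iff) (auto intro: M_psd)
  then have kerq: "\<forall>S\<in>V. apply_mat M V (\<lambda>S. q S $ j) S = 0" if "j < e" for j
    using psd_kernel[OF finV M_sym M_psd] that by blast
  have "(\<Sum>S\<in>V. \<Sum>T\<in>V. M S T * scalar_prod (p S) (p T) - M S T * scalar_prod (q S) (q T)) = 0"
    by (simp add: sum_subtractf p0 q0)
  then have rows: "\<forall>S\<in>V. (\<Sum>T\<in>V. M S T * scalar_prod (p S) (p T) - M S T * scalar_prod (q S) (q T)) = 0"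
    by (subst (asm) sum_nonneg_eq_0_iff) (auto simp: finV intro!: sum_nonneg le)
  then have eqM: "M S T * scalar_prod (p S) (p T) - M S T * scalar_prod (q S) (q T) = 0"
    if "S \<in> V" "T \<in> V" for S T
  proof -
    have "(\<Sum>T\<in>V. M S T * scalar_prod (p S) (p T) - M S T * scalar_prod (q S) (q T)) = 0"
      using rows that(1) by blast
    then have "\<forall>T\<in>V. M S T * scalar_prod (p S) (p T) - M S T * scalar_prod (q S) (q T) = 0"
      by (subst (asm) sum_nonneg_eq_0_iff) (use finV le that(1) in auto)
    then show ?thesis using that(2) by blast
  qed
  have disj: "scalar_prod (q S) (q T) = scalar_prod (p S) (p T)"
    if "S \<in> V" "T \<in> V" "S \<inter> T = {}" for S T
  proof -
    \<comment> \<open>As \<open>r\<close> is positive, disjoint sets differ, so \<open>M S T\<close>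
      is 1 and can be cancelled.\<close>
    have "S \<noteq> T" using that r by (auto simp: ksubsets_def)
    then show ?thesis using eqM[OF that(1,2)] that(3) by (simp add: M_def)
  qed
  obtain Bp where Bp: "\<And>S T. S \<in> V \<Longrightarrow> T \<in> V \<Longrightarrow> scalar_prod (p S) (p T) = (\<Sum>i\<in>S. \<Sum>j\<in>T. Bp i j)"
    using gram_linear[OF p ker] by blast
  obtain Bq where Bq: "\<And>S T. S \<in> V \<Longrightarrow> T \<in> V \<Longrightarrow> scalar_prod (q S) (q T) = (\<Sum>i\<in>S. \<Sum>j\<in>T. Bq i j)"
    using gram_linear[OF q kerq] by blast
  have B: "Bq i j - Bp i j = 0" if "i \<in> X" "j \<in> X" for i j
  proof (rule bilinear_ksubsets_zero[OF finX _ _ _ _ that])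
    show "0 < r" "2 * r < card X" using r cardX by auto
    show "(\<Sum>i\<in>S. \<Sum>j\<in>T. Bq i j - Bp i j) = 0" if "S \<in> V" "T \<in> V" "S \<inter> T = {}" for S T
      using disj[OF that] that by (simp add: sum_subtractf Bp Bq)
    show "(\<Sum>i\<in>S. \<Sum>j\<in>S. Bq i j - Bp i j) = 0" if "S \<in> V" for S
      using diag[OF that] that by (simp add: sum_subtractf Bp Bq)
  qed
  have "(\<Sum>i\<in>S. \<Sum>j\<in>T. Bq i j) = (\<Sum>i\<in>S. \<Sum>j\<in>T. Bp i j)"
    using ST B by (intro sum.cong refl) (auto simp: ksubsets_def subset_iff)
  then show ?thesis using Bp Bq ST by simp
qed

end

section \<open>The columns of \<open>P\<close> and the conclusion\<close>

text \<open>A column is \<open>r\<close> minus \<open>n\<close> times the indicator of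
  \<open>i \<in> S\<close>. Exactly \<open>d\<close> neighbours of \<open>S\<close> contain
  \<open>i\<close> if \<open>i \<notin> S\<close>, and none otherwise; with \<open>absorb\<close>
  the sum is \<open>n * d - n * d\<close> in both cases.\<close>

lemma kneser_P_kernel:
  assumes "kneser X r k d" and X: "X = {1..n}" and i: "i \<in> X" and S: "S \<in> ksubsets X r"
  shows "apply_mat (kneser.M d) (ksubsets X r) (\<lambda>S. kneser_P n r S i) S = 0"
proof -
  interpret kneser X r k d by fact
  have n: "card X = n" using X by simp
  have finS: "finite S" and cS: "card S = r" and sub: "S \<subseteq> X"
    using S finX by (auto simp: ksubsets_def dest: finite_subset)
  have cXS: "card (X - S) = n - r" using finS cS sub n by (simp add: card_Diff_subset)
  have P: "kneser_P n r T i = real r - real n * of_bool (i \<in> T)" for T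
    by (simp add: kneser_P_def)
  have "real r * real (n - r choose r) = real (n - r) * real (n - r - 1 choose k)"
    using arg_cong[OF binomial_absorption[of k "n - r"], of real] r by (simp only: of_nat_mult)
  then have absorb: "real r * real (n - r choose r) = (real n - real r) * d"
    using cardX n d by (simp add: of_nat_diff)
  have "disjoint_sum X r (\<lambda>T. kneser_P n r T i) S
      = real r * real (n - r choose r) - real n * (\<Sum>T\<in>ksubsets (X - S) r. of_bool (i \<in> T))"
    using finX by (simp add: disjoint_sum_def P sum_subtractf sum_distrib_left card_ksubsets cXS)
  moreover have "(\<Sum>T\<in>ksubsets (X - S) r. of_bool (i \<in> T)) = (if i \<in> S then 0 else d)"
  proof (cases "i \<in> S")
    case True
    then show ?thesis by (auto simp: ksubsets_def intro!: sum.neutral)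
  next
    case False
    \<comment> \<open>Neighbours containing \<open>i\<close> arise by adding \<open>i\<close> to a
      \<open>k\<close>-subset of \<open>Y\<close>, whose size \<open>n - r - 1\<close> yields the
      count \<open>d\<close>.\<close>
    define Y where "Y = X - S - {i}"
    have Y: "finite Y" "i \<notin> Y" "X - S = insert i Y" "card Y = n - r - 1"
      using False i finX cXS by (auto simp: Y_def)
    have "(\<Sum>T\<in>ksubsets Y r. of_bool (i \<in> T)) = (0::real)"
      using Y by (auto simp: ksubsets_def intro!: sum.neutral)
    then have "(\<Sum>T\<in>ksubsets (X - S) r. of_bool (i \<in> T)) = real (card (ksubsets Y k))"
      unfolding Y(3) r using sum_ksubsets_insert[OF Y(1,2), of "\<lambda>T. of_bool (i \<in> T)" k] by simp
    then show ?thesis using False Y d n by (simp add: card_ksubsets)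
  qed
  ultimately show ?thesis
    unfolding apply_M[OF S] using absorb by (cases "i \<in> S") (simp_all add: P algebra_simps)
qed

theorem theorem3p18:
  fixes n r :: nat and G :: "nat set tensegrity"
  assumes "r \<ge> 1" and "n \<ge> 2 * r + 1"
    and "tensegrity_graph G"
    and "underlying_graph G = kneser_graph n r"
    and "cables G = {}"
  shows "universally_completable G n (kneser_vec n r)"
proof -
  interpret kneser "{1..n}" r "r - 1" "real (card {1..n} - r - 1 choose (r - 1))"
    by unfold_locales (use assms in auto)
  have vG: "verts G = V"
    using assms(4) by (simp add: underlying_graph_def kneser_graph_def ksubsets_def Let_def)
  have eG: "bars G \<union> struts G = {{S, T} | S T. S \<in> V \<and> T \<in> V \<and> S \<inter> T = {}}"
    using assms(4,5) by (simp add: underlying_graph_def kneser_graph_def ksubsets_def Let_def)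
  have p: "kneser_vec n r S \<in> carrier_vec n" for S by (simp add: kneser_vec_def)
  have ker: "\<forall>S\<in>V. apply_mat M V (\<lambda>S. kneser_vec n r S $ j) S = 0" if "j < n" for j
    using kneser_P_kernel[OF kneser_axioms refl, of "j + 1"] that by (simp add: kneser_vec_def)
  have "gram_matrix G q = gram_matrix G (kneser_vec n r)"
    if q: "tensegrity_framework G e q" and dom: "dominates G (kneser_vec n r) q" for e q
  proof -
    have "scalar_prod (q S) (q T) = scalar_prod (kneser_vec n r S) (kneser_vec n r T)"
      if ST: "S \<in> V" "T \<in> V" for S T
    proof (rule gram_unique[OF p _ ker _ _ ST])
      show "q S \<in> carrier_vec e" if "S \<in> V" for S
        using q that vG by (simp add: tensegrity_framework_def)
      show "scalar_prod (q S) (q S) = scalar_prod (kneser_vec n r S) (kneser_vec n r S)"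
        if "S \<in> V" for S
        using dom that vG by (simp add: dominates_def)
      show "scalar_prod (q S) (q T) \<le> scalar_prod (kneser_vec n r S) (kneser_vec n r T)"
        if "S \<in> V" "T \<in> V" "S \<inter> T = {}" for S T
      proof -
        \<comment> \<open>Without cables, every edge gives the inequality in the required direction,
          a bar even with equality.\<close>
        have "{S, T} \<in> bars G \<union> struts G" unfolding eG using that by blast
        then show ?thesis using dom by (auto simp: dominates_def)
      qed
    qed
    then show ?thesis unfolding gram_matrix_def vG by (intro restrict_ext) auto
  qed
  then show ?thesis
    using assms(3) p by (auto simp: universally_completable_def tensegrity_framework_def)
qed

end
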